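(* Let $f,h,w$ be positive integers, $N=fhw$, let $F\in\mathbb{C}^{N\times N}$ be the three-dimensional DFT matrix of size $(f,h,w)$, and write $F=A+iB$ with $A=\Re(F)$, $B=\Im(F)$. Let $\Lambda$ be a real diagonal $N\times N$ matrix with all diagonal entries in $[0,1]$, and let $\theta\in\mathbb{R}$. Let $\Sigma_{FreeInit}$ and $\Sigma_{FreqPrior}$ be the covariance matrices of the FreeInit refined noise and of the FreqPrior refined noise, respectively, both constructed with the same low-pass filter $\Lambda$, the latter with parameter $\theta$. Then $$\|I-\Sigma_{FreqPrior}\|_F\le \frac{\cos^2\theta}{1+\cos^2\theta}\,\|I-\Sigma_{FreeInit}\|_F .$$ In particular, if $\|I-\Sigma_{FreeInit}\|_F\neq 0$, then $$1-\frac{\|I-\Sigma_{FreqPrior}\|_F}{\|I-\Sigma_{FreeInit}\|_F}\ \ge\ \frac{1}{1+\cos^2\theta}\ \ge\ \frac12 .$$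
   Context: The (one-dimensional) DFT matrix of size $n$ is $F_n=\left(\omega_n^{(m-1)(k-1)}\right)_{1\le m,k\le n}$ with $\omega_n=e^{-2\pi i/n}$; its inverse is $\frac1n F_n^\ast$. The three-dimensional DFT matrix of size $(f,h,w)$ is the Kronecker product $F=F_f\otimes F_h\otimes F_w\in\mathbb{C}^{N\times N}$, $N=fhw$; its inverse is $F^{-1}=\frac1N F^\ast$. $\Re$ and $\Im$ denote entrywise real and imaginary parts, and $\|\cdot\|_F$ is the Frobenius norm. FreeInit refined noise with filter $\Lambda$: let $x,y$ be independent random vectors in $\mathbb{R}^N$, each distributed as $\mathcal{N}(0,I)$, and set $$z=\Re\left(F^{-1}\Lambda F x+F^{-1}(I-\Lambda)F y\right).$$ FreqPrior refined noise with filter $\Lambda$ and parameter $\theta$: let $x,\eta_1,\eta_2,y_1,y_2$ be mutually independent random vectors in $\mathbb{R}^N$, each distributed as $\mathcal{N}(0,I)$. For $j\in\{1,2\}$ set $$x_j=\frac{1}{\sqrt{1+\cos^2\theta}}\left(\cos\theta\, x+\sin\theta\,\eta_j\right),\qquad z_j=F^{-1}\Lambda F x_j+F^{-1}(I-\Lambda^2)^{1/2}F y_j,$$ and $$z=\frac{1}{\sqrt2}\left(\Re(z_1)+\Im(z_1)+\Re(z_2)-\Im(z_2)\right).$$ The covariance error between two Gaussian distributions with the same mean and covariances $\Sigma_1,\Sigma_2$ is $\|\Sigma_1-\Sigma_2\|_F$; the quantities compared are the covariance errors relative to the standard Gaussian. *)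

theory Defs
  imports
    "HOL-Probability.Probability"
    "Jordan_Normal_Form.Gauss_Jordan_Elimination"
begin

unbundle no vec_syntax

section \<open>The three-dimensional DFT matrix\<close>

text \<open>Rows and columns are numbered from 0, so the exponent \<open>(m-1)(k-1)\<close> becomes \<open>m * k\<close>.\<close>

definition dft :: "nat \<Rightarrow> complex mat" where
  "dft n = Matrix.mat n n (\<lambda>(m, k). exp (- (2 * of_real pi * \<i> / of_nat n)) ^ (m * k))"

definition kronecker :: "'a::times mat \<Rightarrow> 'a mat \<Rightarrow> 'a mat" where
  "kronecker A B = Matrix.mat (dim_row A * dim_row B) (dim_col A * dim_col B)
     (\<lambda>(i, j). A $$ (i div dim_row B, j div dim_col B) * B $$ (i mod dim_row B, j mod dim_col B))"

definition dft3 :: "nat \<Rightarrow> nat \<Rightarrow> nat \<Rightarrow> complex mat" where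
  "dft3 f h w = kronecker (kronecker (dft f) (dft h)) (dft w)"

text \<open>The option-valued \<^const>\<open>mat_inverse\<close> is \<^const>\<open>None\<close> only on singular matrices;
  the DFT matrix is invertible when \<open>f, h, w\<close> are positive.\<close>

definition dft3_inv :: "nat \<Rightarrow> nat \<Rightarrow> nat \<Rightarrow> complex mat" where
  "dft3_inv f h w = the (mat_inverse (dft3 f h w))"

definition frobenius_norm :: "'a::real_normed_vector mat \<Rightarrow> real" where
  "frobenius_norm A = sqrt (\<Sum>i<dim_row A. \<Sum>j<dim_col A. (norm (A $$ (i, j)))\<^sup>2)"

text \<open>The nonnegative square root, meant for diagonal matrices with nonnegative entries
  (see the two lemmas below).\<close>

definition diag_sqrt :: "real mat \<Rightarrow> real mat" where
  "diag_sqrt A = mat_diag (dim_row A) (\<lambda>i. sqrt (A $$ (i, i)))"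

lemma diag_sqrt_square:
  assumes "A \<in> carrier_mat n n" "diagonal_mat A" "\<And>i. i < n \<Longrightarrow> A $$ (i, i) \<ge> 0"
  shows "diag_sqrt A * diag_sqrt A = A"
  using assms unfolding diag_sqrt_def mat_diag_diag
  by (intro eq_matI) (auto simp: mat_diag_def diagonal_mat_def)

lemma diag_sqrt_nonneg:
  assumes "A \<in> carrier_mat n n" "\<And>i. i < n \<Longrightarrow> A $$ (i, i) \<ge> 0" "i < n"
  shows "diag_sqrt A $$ (i, i) \<ge> 0"
  using assms by (auto simp: diag_sqrt_def mat_diag_def)


section \<open>Random vectors\<close>

text \<open>The Borel space on the vectors of dimension \<open>N\<close>, transported from the product space.\<close>

definition vec_borel :: "nat \<Rightarrow> real Matrix.vec measure" where
  "vec_borel N = vimage_algebra (carrier_vec N) (\<lambda>v. \<lambda>i\<in>{..<N}. v $ i)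
     (\<Pi>\<^sub>M i\<in>{..<N}. (borel :: real measure))"

text \<open>The Gaussian distribution \<open>N(0, I)\<close>: the product of \<open>N\<close> standard normal distributions.\<close>

definition std_gaussian :: "nat \<Rightarrow> real Matrix.vec measure" where
  "std_gaussian N =
     distr (\<Pi>\<^sub>M i\<in>{..<N}. density lborel std_normal_density) (vec_borel N) (Matrix.vec N)"

definition std_gaussian_vec :: "'a measure \<Rightarrow> nat \<Rightarrow> ('a \<Rightarrow> real Matrix.vec) \<Rightarrow> bool" where
  "std_gaussian_vec M N X \<longleftrightarrow>
     X \<in> measurable M (vec_borel N) \<and> distr M (vec_borel N) X = std_gaussian N"

definition covariance_mat :: "'a measure \<Rightarrow> nat \<Rightarrow> ('a \<Rightarrow> real Matrix.vec) \<Rightarrow> real mat" where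
  "covariance_mat M N Z = Matrix.mat N N (\<lambda>(i, j).
     (\<integral>\<omega>. (Z \<omega> $ i - (\<integral>\<xi>. Z \<xi> $ i \<partial>M)) * (Z \<omega> $ j - (\<integral>\<xi>. Z \<xi> $ j \<partial>M)) \<partial>M))"

lemma space_vec_borel: "space (vec_borel N) = carrier_vec N"
  by (simp add: vec_borel_def)

lemma measurable_vec_std_normal:
  "Matrix.vec N \<in> measurable (\<Pi>\<^sub>M i\<in>{..<N}. density lborel std_normal_density) (vec_borel N)"
proof -
  have "(\<lambda>x. \<lambda>i\<in>{..<N}. Matrix.vec N x $ i)
      \<in> measurable (\<Pi>\<^sub>M i\<in>{..<N}. density lborel std_normal_density) (\<Pi>\<^sub>M i\<in>{..<N}. borel)"
  proof (rule measurable_restrict)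
    fix i assume i: "i \<in> {..<N}"
    have "(\<lambda>x. x i) \<in> measurable (\<Pi>\<^sub>M i\<in>{..<N}. density lborel std_normal_density)
        (density lborel std_normal_density)"
      using i by (rule measurable_component_singleton)
    also have "measurable (\<Pi>\<^sub>M i\<in>{..<N}. density lborel std_normal_density)
        (density lborel std_normal_density) =
      measurable (\<Pi>\<^sub>M i\<in>{..<N}. density lborel std_normal_density) (borel :: real measure)"
      by (rule measurable_cong_sets) simp_all
    finally show "(\<lambda>x. Matrix.vec N x $ i)
        \<in> measurable (\<Pi>\<^sub>M i\<in>{..<N}. density lborel std_normal_density) borel"
      using i by simp
  qed
  then show ?thesis
    unfolding vec_borel_def by (intro measurable_vimage_algebra2) auto
qed

lemma prob_space_std_gaussian: "prob_space (std_gaussian N)"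
  unfolding std_gaussian_def
  by (intro prob_space.prob_space_distr prob_space_PiM measurable_vec_std_normal)
     (auto intro: prob_space_normal_density)

lemma distr_std_gaussian_component:
  assumes "i < N"
  shows "distr (std_gaussian N) borel (\<lambda>v. v $ i) = density lborel std_normal_density"
proof -
  let ?P = "\<Pi>\<^sub>M i\<in>{..<N}. density lborel std_normal_density"
  have restr: "(\<lambda>v. \<lambda>i\<in>{..<N}. v $ i) \<in> measurable (vec_borel N) (\<Pi>\<^sub>M i\<in>{..<N}. (borel :: real measure))"
    unfolding vec_borel_def by (rule measurable_vimage_algebra1) (auto simp: space_PiM)
  have comp: "(\<lambda>v. v $ i) \<in> measurable (vec_borel N) (borel :: real measure)"
    using measurable_compose[OF restr measurable_component_singleton[of i]] assms by simp
  have "distr (std_gaussian N) borel (\<lambda>v. v $ i) = distr ?P borel (\<lambda>x. x i)"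
    unfolding std_gaussian_def
    by (subst distr_distr[OF comp measurable_vec_std_normal])
       (intro distr_cong, use assms in auto)
  also have "\<dots> = distr ?P (density lborel std_normal_density) (\<lambda>x. x i)"
    by (intro distr_cong) auto
  also have "\<dots> = density lborel std_normal_density"
    using assms by (intro distr_PiM_component prob_space_normal_density) auto
  finally show ?thesis .
qed


section \<open>The refined noises\<close>

definition freeinit_noise ::
  "nat \<Rightarrow> nat \<Rightarrow> nat \<Rightarrow> real mat \<Rightarrow> real Matrix.vec \<Rightarrow> real Matrix.vec \<Rightarrow> real Matrix.vec" where
  "freeinit_noise f h w \<Lambda> x y =
     (let F = dft3 f h w; F' = dft3_inv f h w; N = f * h * w;
          C = map_mat complex_of_real; c = map_vec complex_of_real
      in map_vec Re ((F' * C \<Lambda> * F) *\<^sub>v c x + (F' * C (1\<^sub>m N - \<Lambda>) * F) *\<^sub>v c y))"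

definition freqprior_mix ::
  "real \<Rightarrow> real Matrix.vec \<Rightarrow> real Matrix.vec \<Rightarrow> real Matrix.vec" where
  "freqprior_mix \<theta> x \<eta> =
     (1 / sqrt (1 + (cos \<theta>)\<^sup>2)) \<cdot>\<^sub>v (cos \<theta> \<cdot>\<^sub>v x + sin \<theta> \<cdot>\<^sub>v \<eta>)"

definition freqprior_filter ::
  "nat \<Rightarrow> nat \<Rightarrow> nat \<Rightarrow> real mat \<Rightarrow> real Matrix.vec \<Rightarrow> real Matrix.vec \<Rightarrow> complex Matrix.vec" where
  "freqprior_filter f h w \<Lambda> x y =
     (let F = dft3 f h w; F' = dft3_inv f h w; N = f * h * w;
          C = map_mat complex_of_real; c = map_vec complex_of_real
      in (F' * C \<Lambda> * F) *\<^sub>v c x + (F' * C (diag_sqrt (1\<^sub>m N - \<Lambda> * \<Lambda>)) * F) *\<^sub>v c y)"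

definition freqprior_noise ::
  "nat \<Rightarrow> nat \<Rightarrow> nat \<Rightarrow> real mat \<Rightarrow> real \<Rightarrow> real Matrix.vec \<Rightarrow> real Matrix.vec \<Rightarrow> real Matrix.vec \<Rightarrow>
     real Matrix.vec \<Rightarrow> real Matrix.vec \<Rightarrow> real Matrix.vec" where
  "freqprior_noise f h w \<Lambda> \<theta> x \<eta>\<^sub>1 \<eta>\<^sub>2 y\<^sub>1 y\<^sub>2 =
     (let z\<^sub>1 = freqprior_filter f h w \<Lambda> (freqprior_mix \<theta> x \<eta>\<^sub>1) y\<^sub>1;
          z\<^sub>2 = freqprior_filter f h w \<Lambda> (freqprior_mix \<theta> x \<eta>\<^sub>2) y\<^sub>2
      in (1 / sqrt 2) \<cdot>\<^sub>v (map_vec Re z\<^sub>1 + map_vec Im z\<^sub>1 + map_vec Re z\<^sub>2 - map_vec Im z\<^sub>2))"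

end

theory Submission
  imports Defs "Jordan_Normal_Form.Determinant"
begin

text \<open>For a real filter \<open>d\<close> the matrix \<open>G = F\<^sup>-\<^sup>1 diag(d) F = P + \<i>Q\<close> is Hermitian, so \<open>P\<close> is symmetric and
  \<open>Q\<close> antisymmetric, and \<open>G\<^sup>2\<close> is the filter of \<open>d\<^sup>2\<close>. Let \<open>S = Q Q\<^sup>T\<close>, let \<open>R\<close> be the real part of the filter
  of \<open>d - d\<^sup>2\<close>, and let \<open>\<kappa> = cos\<^sup>2 \<theta> / (1 + cos\<^sup>2 \<theta>)\<close>. Then \<open>I - \<Sigma>\<close> is \<open>2 (R + S)\<close> for FreeInit
  and \<open>2 \<kappa> S\<close> for FreqPrior. As \<open>0 \<le> d \<le> 1\<close>, both \<open>R\<close> and \<open>S\<close> are positive semidefinite, so their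
  Frobenius inner product is nonnegative and \<open>\<parallel>S\<parallel> \<le> \<parallel>R + S\<parallel>\<close>.\<close>

section \<open>Orthogonality of the DFT matrix\<close>

text \<open>This is \<open>A^* A = n I\<close> entrywise. Keeping the factor \<open>n\<close>
  instead of normalising makes the property pass to Kronecker products with no rescaling, since the
  sizes multiply.\<close>

definition orthogonal_columns :: "complex mat \<Rightarrow> bool" where
  "orthogonal_columns A \<longleftrightarrow> square_mat A \<and> (\<forall>i<dim_row A. \<forall>j<dim_row A.
     (\<Sum>k<dim_row A. cnj (A $$ (k, i)) * A $$ (k, j)) = (if i = j then of_nat (dim_row A) else 0))"

lemma dim_dft [simp]: "dim_row (dft n) = n" "dim_col (dft n) = n"
  by (simp_all add: dft_def)

text \<open>The inner product of two columns is a geometric sum in an n-th root of unity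
  \<open>r\<close>, and \<open>r\<close> equals 1 exactly when the two column indices agree.\<close>

lemma orthogonal_columns_dft: "orthogonal_columns (dft n)"
  unfolding orthogonal_columns_def dim_dft
proof (intro conjI allI impI)
  fix i j assume i: "i < n" and j: "j < n"
  define a :: complex where "a = exp (- (2 * of_real pi * \<i> / of_nat n))"
  define r where "r = cnj (a ^ i) * a ^ j"
  have n: "n > 0" using i by simp
  have cnj_a: "cnj a = inverse a"
    by (simp add: a_def exp_cnj flip: exp_minus)
  have a0: "a \<noteq> 0" by (simp add: a_def)
  have an: "a ^ n = 1"
    using n complex_root_unity[of n 1] by (simp add: a_def exp_minus power_inverse)
  have rn: "r ^ n = 1"
    using an cnj_a by (simp add: r_def power_mult_distrib power_inverse flip: power_mult)
      (simp add: power_mult mult.commute[of _ n])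
  have dft: "dft n $$ (k, l) = a ^ (k * l)" if "k < n" "l < n" for k l
    using that by (simp add: dft_def a_def)
  have "cnj (a ^ (k * i)) * a ^ (k * j) = r ^ k" for k
    unfolding r_def power_mult_distrib complex_cnj_power power_mult[symmetric]
    by (simp only: mult.commute[of k])
  then have "(\<Sum>k<n. cnj (dft n $$ (k, i)) * dft n $$ (k, j)) = (\<Sum>k<n. r ^ k)"
    using i j dft by (intro sum.cong) auto
  also have "\<dots> = (if i = j then of_nat n else 0)"
  proof (cases "i = j")
    case True
    then have "r = 1" using a0 cnj_a by (simp add: r_def power_inverse)
    then show ?thesis using True by simp
  next
    case False
    have "r \<noteq> 1"
    proof
      assume "r = 1"
      then have "a ^ i = a ^ j"
        using a0 cnj_a by (simp add: r_def field_simps power_inverse)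
      then have "exp (of_nat i * (- (2 * of_real pi * \<i> / of_nat n)))
           = exp (of_nat j * (- (2 * of_real pi * \<i> / of_nat n)))"
        by (simp only: a_def exp_of_nat_mult)
      \<comment> \<open>Inverting both sides passes from the DFT root to exp(2 pi i / n), whose
        powers agree only for congruent exponents. Both exponents are below \<open>n\<close>, so
        congruence means equality.\<close>
      then have "exp (2 * of_real pi * \<i> * of_nat i / of_nat n) = exp (2 * of_real pi * \<i> * of_nat j / of_nat n)"
        by (simp add: exp_minus field_simps)
      then have "i mod n = j mod n"
        using complex_root_unity_eq[of n i j] n by (simp add: cong_def)
      then show False using i j False by simp
    qed
    then show ?thesis
      using False rn sum_gp_strict[of r n] by simp
  qed
  finally show "(\<Sum>k<n. cnj (dft n $$ (k, i)) * dft n $$ (k, j)) = (if i = j then of_nat n else 0)" .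
qed simp

text \<open>Splitting the row index into quotient and remainder modulo \<open>b\<close> factors the
  inner product of two columns into one inner product for \<open>A\<close> and one for
  \<open>B\<close>.\<close>

lemma orthogonal_columns_kronecker:
  assumes A: "orthogonal_columns A" and B: "orthogonal_columns B"
  shows "orthogonal_columns (kronecker A B)"
proof -
  define a b where "a = dim_row A" and "b = dim_row B"
  have dims: "dim_row A = a" "dim_col A = a" "dim_row B = b" "dim_col B = b"
    using A B by (auto simp: a_def b_def orthogonal_columns_def)
  have "(\<Sum>k<a * b. cnj (kronecker A B $$ (k, i)) * kronecker A B $$ (k, j)) =
      (if i = j then of_nat (a * b) else 0)" if i: "i < a * b" and j: "j < a * b" for i j
  proof -
    have b: "b > 0" using i by (cases b) auto
    have lt: "i div b < a" "j div b < a" "i mod b < b" "j mod b < b"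
      using i j b by (simp_all add: less_mult_imp_div_less)
    have "(\<Sum>k<a * b. cnj (kronecker A B $$ (k, i)) * kronecker A B $$ (k, j)) =
       (\<Sum>k<a. \<Sum>l<b. (cnj (A $$ (k, i div b)) * A $$ (k, j div b)) *
          (cnj (B $$ (l, i mod b)) * B $$ (l, j mod b)))"
      unfolding sum_mult_product
    proof (intro sum.cong refl)
      fix k l assume kl: "k \<in> {..<a}" "l \<in> {..<b}"
      have "l + k * b < a * b"
        using kl mult_le_mono1[of "Suc k" a b] by simp
      then show "cnj (kronecker A B $$ (l + k * b, i)) * kronecker A B $$ (l + k * b, j) =
          (cnj (A $$ (k, i div b)) * A $$ (k, j div b)) * (cnj (B $$ (l, i mod b)) * B $$ (l, j mod b))"
        using kl i j b by (simp add: kronecker_def dims)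
    qed
    also have "\<dots> = (\<Sum>k<a. cnj (A $$ (k, i div b)) * A $$ (k, j div b)) *
        (\<Sum>l<b. cnj (B $$ (l, i mod b)) * B $$ (l, j mod b))"
      by (simp add: sum_product)
    also have "\<dots> = (if i div b = j div b then of_nat a else 0) * (if i mod b = j mod b then of_nat b else 0)"
      using A B lt by (simp add: orthogonal_columns_def dims)
    also have "\<dots> = (if i = j then of_nat (a * b) else 0)"
    proof -
      have "i div b = j div b \<and> i mod b = j mod b \<longleftrightarrow> i = j"
        by (metis div_mult_mod_eq)
      then show ?thesis by auto
    qed
    finally show ?thesis .
  qed
  then show ?thesis
    by (simp add: orthogonal_columns_def kronecker_def dims)
qed

lemma dft3_carrier: "dft3 f h w \<in> carrier_mat (f * h * w) (f * h * w)"
  by (simp add: dft3_def kronecker_def)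

lemma orthogonal_columns_dft3: "orthogonal_columns (dft3 f h w)"
  unfolding dft3_def by (intro orthogonal_columns_kronecker orthogonal_columns_dft)

section \<open>The inverse of the three-dimensional DFT matrix\<close>

text \<open>Column orthogonality makes \<open>F^* / N\<close> a left inverse, and a left inverse of
  a square matrix is two-sided. The second claim later supplies orthogonality of the rows.\<close>

lemma dft3_inverts:
  assumes "f > 0" "h > 0" "w > 0" "N = f * h * w"
  shows "dft3_inv f h w = Matrix.mat N N (\<lambda>(i, k). cnj (dft3 f h w $$ (k, i)) / of_nat N)"
    and "dft3 f h w * dft3_inv f h w = 1\<^sub>m N"
proof -
  define F where "F = dft3 f h w"
  define G where "G = Matrix.mat N N (\<lambda>(i, k). cnj (F $$ (k, i)) / of_nat N)"
  have N: "N > 0" using assms by simp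
  have F: "F \<in> carrier_mat N N" using dft3_carrier assms by (simp add: F_def)
  have G: "G \<in> carrier_mat N N" by (simp add: G_def)
  have GF: "G * F = 1\<^sub>m N"
  proof (rule eq_matI)
    fix i j assume "i < dim_row (1\<^sub>m N)" "j < dim_col (1\<^sub>m N)"
    then have ij: "i < N" "j < N" by auto
    have "(G * F) $$ (i, j) = (\<Sum>k<N. cnj (F $$ (k, i)) / of_nat N * F $$ (k, j))"
      using F ij by (simp add: G_def scalar_prod_def atLeast0LessThan)
    also have "\<dots> = (\<Sum>k<N. cnj (F $$ (k, i)) * F $$ (k, j)) / of_nat N"
      by (simp add: sum_divide_distrib)
    also have "\<dots> = 1\<^sub>m N $$ (i, j)"
      using orthogonal_columns_dft3[of f h w] F ij N
      unfolding F_def[symmetric] orthogonal_columns_def by simp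
    finally show "(G * F) $$ (i, j) = 1\<^sub>m N $$ (i, j)" .
  qed (use F G in auto)
  have FG: "F * G = 1\<^sub>m N"
    using mat_mult_left_right_inverse[OF G F GF] .
  \<comment> \<open>Invertibility excludes the result \<open>None\<close> of
    \<open>mat_inverse\<close>, so the \<open>the\<close> in \<open>dft3_inv\<close> is meaningful.
    The matrix found is then \<open>G\<close> by uniqueness of inverses.\<close>
  have "F \<in> Units (ring_mat TYPE(complex) N ())"
    using F G GF FG unfolding Units_def by (auto simp: ring_mat_simps)
  then obtain B where "mat_inverse F = Some B"
    using mat_inverse(1)[OF F, of "()"] by (cases "mat_inverse F") auto
  then have B: "dft3_inv f h w = B" "F * B = 1\<^sub>m N" "B \<in> carrier_mat N N"
    using mat_inverse(2)[OF F] by (auto simp: dft3_inv_def F_def)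
  have "B = G * F * B" using B GF by simp
  also have "\<dots> = G" using B F G by (simp add: assoc_mult_mat[of _ N N _ N _ N])
  finally show "dft3_inv f h w = Matrix.mat N N (\<lambda>(i, k). cnj (dft3 f h w $$ (k, i)) / of_nat N)"
    using B by (simp add: G_def F_def)
  show "dft3 f h w * dft3_inv f h w = 1\<^sub>m N"
    using B by (simp add: F_def)
qed

section \<open>Covariance of linear forms in Gaussian vectors\<close>

lemma measurable_vec_borel_component:
  assumes "i < N"
  shows "(\<lambda>v. v $ i) \<in> borel_measurable (vec_borel N)"
proof -
  have "(\<lambda>v. \<lambda>i\<in>{..<N}. v $ i) \<in> measurable (vec_borel N) (\<Pi>\<^sub>M i\<in>{..<N}. (borel :: real measure))"
    unfolding vec_borel_def by (rule measurable_vimage_algebra1) (auto simp: space_PiM)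
  from measurable_compose[OF this measurable_component_singleton[of i]] show ?thesis
    using assms by simp
qed

lemma std_gaussian_integral_eq:
  fixes g :: "real Matrix.vec \<Rightarrow> real"
  assumes X: "std_gaussian_vec M N X" and g: "g \<in> borel_measurable (vec_borel N)"
  shows "integrable M (\<lambda>\<omega>. g (X \<omega>)) \<longleftrightarrow> integrable (std_gaussian N) g"
    and "(\<integral>\<omega>. g (X \<omega>) \<partial>M) = (\<integral>v. g v \<partial>std_gaussian N)"
proof -
  have meas: "X \<in> measurable M (vec_borel N)" and "distr M (vec_borel N) X = std_gaussian N"
    using X by (auto simp: std_gaussian_vec_def)
  then show "integrable M (\<lambda>\<omega>. g (X \<omega>)) \<longleftrightarrow> integrable (std_gaussian N) g"
    "(\<integral>\<omega>. g (X \<omega>) \<partial>M) = (\<integral>v. g v \<partial>std_gaussian N)"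
    using integrable_distr_eq[OF meas g] integral_distr[OF meas g] by simp_all
qed

lemma integral_std_gaussian_component:
  fixes g :: "real \<Rightarrow> real"
  assumes i: "i < N" and g: "g \<in> borel_measurable borel"
  shows "integrable (std_gaussian N) (\<lambda>v. g (v $ i)) \<longleftrightarrow> integrable std_normal_distribution g"
    and "(\<integral>v. g (v $ i) \<partial>std_gaussian N) = integral\<^sup>L std_normal_distribution g"
proof -
  have meas: "(\<lambda>v. v $ i) \<in> measurable (std_gaussian N) borel"
    using measurable_vec_borel_component[OF i] by (simp add: std_gaussian_def)
  show "integrable (std_gaussian N) (\<lambda>v. g (v $ i)) \<longleftrightarrow> integrable std_normal_distribution g"
    "(\<integral>v. g (v $ i) \<partial>std_gaussian N) = integral\<^sup>L std_normal_distribution g"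
    using integrable_distr_eq[OF meas g] integral_distr[OF meas g] distr_std_gaussian_component[OF i]
    by simp_all
qed

lemma std_gaussian_component_moments:
  assumes "std_gaussian_vec M N X" "i < N"
  shows "integrable M (\<lambda>\<omega>. X \<omega> $ i)" "(\<integral>\<omega>. X \<omega> $ i \<partial>M) = 0"
    and "integrable M (\<lambda>\<omega>. (X \<omega> $ i)\<^sup>2)" "(\<integral>\<omega>. (X \<omega> $ i)\<^sup>2 \<partial>M) = 1"
proof -
  have mi[measurable]: "(\<lambda>v. v $ i) \<in> borel_measurable (vec_borel N)"
    using assms(2) by (rule measurable_vec_borel_component)
  have msq: "(\<lambda>v. (v $ i)\<^sup>2) \<in> borel_measurable (vec_borel N)" by measurable
  have id_borel: "(\<lambda>x::real. x) \<in> borel_measurable borel"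
    and sq_borel: "(\<lambda>x::real. x\<^sup>2) \<in> borel_measurable borel" by measurable
  have first: "integrable std_normal_distribution (\<lambda>x. x)" "(\<integral>x. x \<partial>std_normal_distribution) = 0"
    using integrable_std_normal_distribution_moment[of 1] integral_std_normal_distribution_moment_odd[of 1]
    by simp_all
  have second: "integrable std_normal_distribution (\<lambda>x. x\<^sup>2)" "(\<integral>x. x\<^sup>2 \<partial>std_normal_distribution) = 1"
    using std_normal_distribution_even_moments[of 1] by (simp_all add: fact_2)
  show "integrable M (\<lambda>\<omega>. X \<omega> $ i)" "(\<integral>\<omega>. X \<omega> $ i \<partial>M) = 0"
    unfolding std_gaussian_integral_eq[OF assms(1) mi]
      integral_std_gaussian_component[OF assms(2), of "\<lambda>x. x", OF id_borel]
    by (fact first)+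
  show "integrable M (\<lambda>\<omega>. (X \<omega> $ i)\<^sup>2)" "(\<integral>\<omega>. (X \<omega> $ i)\<^sup>2 \<partial>M) = 1"
    unfolding std_gaussian_integral_eq[OF assms(1) msq]
      integral_std_gaussian_component[OF assms(2), of "\<lambda>x. x\<^sup>2", OF sq_borel]
    by (fact second)+
qed

text \<open>Under the product measure the integral of a product of one-variable functions factors,
  and the factor at \<open>i\<close> is the mean of a standard normal variable, namely 0.\<close>

lemma std_gaussian_components_uncorrelated:
  assumes X: "std_gaussian_vec M N X" and ij: "i < N" "j < N" "i \<noteq> j"
  shows "integrable M (\<lambda>\<omega>. X \<omega> $ i * X \<omega> $ j)" "(\<integral>\<omega>. X \<omega> $ i * X \<omega> $ j \<partial>M) = 0"
proof -
  interpret product_sigma_finite "\<lambda>_::nat. std_normal_distribution"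
    by (intro product_sigma_finite.intro prob_space_imp_sigma_finite prob_space_normal_density) simp
  let ?P = "\<Pi>\<^sub>M k\<in>{..<N}. std_normal_distribution"
  \<comment> \<open>Padding with the constant 1 off \<open>i\<close> and \<open>j\<close> turns
    \<open>x i * x j\<close> into a product over all coordinates, the shape required by the product
    rule for integrals.\<close>
  let ?f = "\<lambda>k x::real. if k \<in> {i, j} then x else 1"
  interpret nd: prob_space std_normal_distribution
    by (rule prob_space_normal_density) simp
  have first: "integrable std_normal_distribution (\<lambda>x. x)" "(\<integral>x. x \<partial>std_normal_distribution) = 0"
    using integrable_std_normal_distribution_moment[of 1] integral_std_normal_distribution_moment_odd[of 1]
    by simp_all
  have int: "integrable std_normal_distribution (?f k)" for k
    using first by (cases "k \<in> {i, j}") auto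
  have prod: "(\<Prod>k<N. ?f k (x k)) = x i * x j" for x
  proof -
    have "(\<Prod>k<N. ?f k (x k)) = (\<Prod>k\<in>{i, j}. x k)"
      using ij by (intro prod.mono_neutral_cong_right) auto
    then show ?thesis using ij by simp
  qed
  have "(\<integral>x. x i * x j \<partial>?P) = (\<Prod>k<N. integral\<^sup>L std_normal_distribution (?f k))"
    using product_integral_prod[of "{..<N}" ?f] int unfolding prod by simp
  also have "\<dots> = 0"
    using ij first(2) by (intro prod_zero) (auto intro!: bexI[of _ i])
  finally have P: "(\<integral>x. x i * x j \<partial>?P) = 0" .
  have PI: "integrable ?P (\<lambda>x. x i * x j)"
    using product_integrable_prod[of "{..<N}" ?f] int unfolding prod by simp
  have [measurable]: "(\<lambda>v. v $ i) \<in> borel_measurable (vec_borel N)" "(\<lambda>v. v $ j) \<in> borel_measurable (vec_borel N)"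
    using ij by (auto intro: measurable_vec_borel_component)
  have m: "(\<lambda>v. v $ i * v $ j) \<in> borel_measurable (vec_borel N)" by measurable
  have "integrable (std_gaussian N) (\<lambda>v. v $ i * v $ j)" "(\<integral>v. v $ i * v $ j \<partial>std_gaussian N) = 0"
    using integrable_distr_eq[OF measurable_vec_std_normal m] integral_distr[OF measurable_vec_std_normal m] P PI ij
    by (simp_all add: std_gaussian_def)
  then show "integrable M (\<lambda>\<omega>. X \<omega> $ i * X \<omega> $ j)" "(\<integral>\<omega>. X \<omega> $ i * X \<omega> $ j \<partial>M) = 0"
    using std_gaussian_integral_eq[OF X m] by simp_all
qed

lemma (in prob_space) indep_std_gaussian_components_uncorrelated:
  assumes X: "std_gaussian_vec M N X" and Y: "std_gaussian_vec M N Y"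
    and indep: "indep_var (vec_borel N) X (vec_borel N) Y" and ij: "i < N" "j < N"
  shows "integrable M (\<lambda>\<omega>. X \<omega> $ i * Y \<omega> $ j)" "(\<integral>\<omega>. X \<omega> $ i * Y \<omega> $ j \<partial>M) = 0"
proof -
  have "indep_var borel (\<lambda>\<omega>. X \<omega> $ i) borel (\<lambda>\<omega>. Y \<omega> $ j)"
    using indep_var_compose[OF indep measurable_vec_borel_component[OF ij(1)] measurable_vec_borel_component[OF ij(2)]]
    by (simp add: comp_def)
  then show "integrable M (\<lambda>\<omega>. X \<omega> $ i * Y \<omega> $ j)" "(\<integral>\<omega>. X \<omega> $ i * Y \<omega> $ j \<partial>M) = 0"
    using indep_var_integrable[of "\<lambda>\<omega>. X \<omega> $ i" "\<lambda>\<omega>. Y \<omega> $ j"]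
      indep_var_lebesgue_integral[of "\<lambda>\<omega>. X \<omega> $ i" "\<lambda>\<omega>. Y \<omega> $ j"]
      std_gaussian_component_moments[OF X ij(1)] std_gaussian_component_moments[OF Y ij(2)]
    by simp_all
qed

text \<open>Disjoint blocks of an independent family are independent. The blocks here are two
  singletons, each followed by the projection to its only coordinate.\<close>

lemma (in prob_space) indep_vars_imp_indep_var:
  assumes indep: "indep_vars M' X I" and kl: "k \<in> I" "l \<in> I" "k \<noteq> l"
  shows "indep_var (M' k) (X k) (M' l) (X l)"
proof -
  have "indep_var (M' k) ((\<lambda>f. f k) \<circ> (\<lambda>\<omega>. restrict (\<lambda>i. X i \<omega>) {k}))
      (M' l) ((\<lambda>f. f l) \<circ> (\<lambda>\<omega>. restrict (\<lambda>i. X i \<omega>) {l}))"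
    using kl by (intro indep_var_compose[OF indep_var_restrict[OF indep]] measurable_component_singleton) auto
  then show ?thesis
    by (simp add: comp_def)
qed

section \<open>Covariance of a linear image of uncorrelated variables\<close>

text \<open>For centred variables that are orthonormal in L2, the covariance of \<open>L g\<close>
  is \<open>L L^T\<close>: the means vanish, and the double sum from the product collapses to its
  diagonal.\<close>

lemma covariance_linear_forms:
  fixes g :: "'c \<Rightarrow> 'a \<Rightarrow> real"
  assumes A: "finite A"
    and g: "\<And>a. a \<in> A \<Longrightarrow> integrable M (g a)" "\<And>a. a \<in> A \<Longrightarrow> (\<integral>\<omega>. g a \<omega> \<partial>M) = 0"
    and gg: "\<And>a b. a \<in> A \<Longrightarrow> b \<in> A \<Longrightarrow> integrable M (\<lambda>\<omega>. g a \<omega> * g b \<omega>)"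
      "\<And>a b. a \<in> A \<Longrightarrow> b \<in> A \<Longrightarrow> (\<integral>\<omega>. g a \<omega> * g b \<omega> \<partial>M) = (if a = b then 1 else 0)"
    and Z: "\<And>\<omega> i. \<omega> \<in> space M \<Longrightarrow> i < N \<Longrightarrow> Z \<omega> $ i = (\<Sum>a\<in>A. L i a * g a \<omega>)"
  shows "covariance_mat M N Z = Matrix.mat N N (\<lambda>(i, j). \<Sum>a\<in>A. L i a * L j a)"
proof -
  have mean: "(\<integral>\<omega>. Z \<omega> $ i \<partial>M) = 0" if "i < N" for i
  proof -
    have "(\<integral>\<omega>. Z \<omega> $ i \<partial>M) = (\<integral>\<omega>. (\<Sum>a\<in>A. L i a * g a \<omega>) \<partial>M)"
      using Z that by (intro Bochner_Integration.integral_cong) auto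
    also have "\<dots> = 0" using g by simp
    finally show ?thesis .
  qed
  have "(\<integral>\<omega>. (Z \<omega> $ i - (\<integral>\<xi>. Z \<xi> $ i \<partial>M)) * (Z \<omega> $ j - (\<integral>\<xi>. Z \<xi> $ j \<partial>M)) \<partial>M)
      = (\<Sum>a\<in>A. L i a * L j a)" if ij: "i < N" "j < N" for i j
  proof -
    have "(\<integral>\<omega>. (Z \<omega> $ i - (\<integral>\<xi>. Z \<xi> $ i \<partial>M)) * (Z \<omega> $ j - (\<integral>\<xi>. Z \<xi> $ j \<partial>M)) \<partial>M)
        = (\<integral>\<omega>. (\<Sum>a\<in>A. \<Sum>b\<in>A. (L i a * L j b) * (g a \<omega> * g b \<omega>)) \<partial>M)"
      using Z ij by (intro Bochner_Integration.integral_cong) (auto simp: mean sum_product mult_ac)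
    also have "\<dots> = (\<Sum>a\<in>A. \<Sum>b\<in>A. (L i a * L j b) * (if a = b then 1 else 0))"
      using gg by simp
    also have "\<dots> = (\<Sum>a\<in>A. L i a * L j a)"
      using A by (simp add: if_distrib[of "\<lambda>x. _ * x"] cong: if_cong)
    finally show ?thesis .
  qed
  then show ?thesis
    unfolding covariance_mat_def by (intro eq_matI) auto
qed

text \<open>The orthonormal family consists of all coordinates of all vectors, indexed by pairs
  (vector, coordinate). Pairwise independence is asked only for \<open>k < l\<close>, since the
  reversed pairs follow by commutativity.\<close>

lemma (in prob_space) covariance_gaussian_linear_forms:
  fixes X :: "nat \<Rightarrow> 'a \<Rightarrow> real Matrix.vec"
  assumes X: "\<And>k. k < K \<Longrightarrow> std_gaussian_vec M N (X k)"
    and indep: "\<And>k l. k < l \<Longrightarrow> l < K \<Longrightarrow> indep_var (vec_borel N) (X k) (vec_borel N) (X l)"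
    and Z: "\<And>\<omega> i. \<omega> \<in> space M \<Longrightarrow> i < N \<Longrightarrow> Z \<omega> $ i = (\<Sum>k<K. \<Sum>m<N. L k i m * X k \<omega> $ m)"
  shows "covariance_mat M N Z = Matrix.mat N N (\<lambda>(i, j). \<Sum>k<K. \<Sum>m<N. L k i m * L k j m)"
proof -
  have "covariance_mat M N Z = Matrix.mat N N (\<lambda>(i, j). \<Sum>a\<in>{..<K} \<times> {..<N}.
      (case a of (k, m) \<Rightarrow> L k i m) * (case a of (k, m) \<Rightarrow> L k j m))"
  proof (rule covariance_linear_forms[where g = "\<lambda>(k, m) \<omega>. X k \<omega> $ m"])
    fix a b assume "a \<in> {..<K} \<times> {..<N}" "b \<in> {..<K} \<times> {..<N}"
    then obtain k m l n where ab: "a = (k, m)" "b = (l, n)" "k < K" "l < K" "m < N" "n < N"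
      by auto
    have "integrable M (\<lambda>\<omega>. X k \<omega> $ m * X l \<omega> $ n) \<and>
        (\<integral>\<omega>. X k \<omega> $ m * X l \<omega> $ n \<partial>M) = (if k = l \<and> m = n then 1 else 0)"
    \<comment> \<open>Coordinates of different vectors are uncorrelated by independence. Within one
      vector, distinct coordinates are uncorrelated, and equal ones give the variance 1.\<close>
    proof (cases k l rule: linorder_cases)
      case less
      then show ?thesis
        using indep_std_gaussian_components_uncorrelated[OF X[OF ab(3)] X[OF ab(4)] indep[OF less ab(4)] ab(5,6)]
        by simp
    next
      case equal
      then show ?thesis
        using std_gaussian_component_moments(3,4)[OF X[OF ab(3)] ab(5)]
          std_gaussian_components_uncorrelated[OF X[OF ab(3)] ab(5,6)]
        by (cases "m = n") (simp_all add: power2_eq_square)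
    next
      case greater
      then show ?thesis
        using indep_std_gaussian_components_uncorrelated[OF X[OF ab(4)] X[OF ab(3)] indep[OF greater ab(3)] ab(6,5)]
        by (simp add: mult.commute[of "X l _ $ n"])
    qed
    then show "integrable M (\<lambda>\<omega>. (case a of (k, m) \<Rightarrow> \<lambda>\<omega>. X k \<omega> $ m) \<omega> * (case b of (k, m) \<Rightarrow> \<lambda>\<omega>. X k \<omega> $ m) \<omega>)"
      "(\<integral>\<omega>. (case a of (k, m) \<Rightarrow> \<lambda>\<omega>. X k \<omega> $ m) \<omega> * (case b of (k, m) \<Rightarrow> \<lambda>\<omega>. X k \<omega> $ m) \<omega> \<partial>M)
        = (if a = b then 1 else 0)"
      by (simp_all add: ab(1,2))
  qed (auto simp: Z std_gaussian_component_moments[OF X] sum.cartesian_product split_def)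
  then show ?thesis
    by (simp add: sum.cartesian_product split_def)
qed

section \<open>Spectral filters\<close>

text \<open>The filter algebra rests on \<open>F^* F = F F^* = N I\<close> alone. Matrices are given
  by their entry functions, so that it can be carried out with finite sums.\<close>

locale scaled_unitary =
  fixes N :: nat and F :: "nat \<Rightarrow> nat \<Rightarrow> complex"
  assumes N_pos: "N > 0"
    and columns: "\<And>i j. i < N \<Longrightarrow> j < N \<Longrightarrow>
      (\<Sum>k<N. cnj (F k i) * F k j) = (if i = j then of_nat N else 0)"
    and rows: "\<And>i j. i < N \<Longrightarrow> j < N \<Longrightarrow>
      (\<Sum>k<N. F i k * cnj (F j k)) = (if i = j then of_nat N else 0)"
begin

text \<open>The entry at \<open>(i, j)\<close> of \<open>F^-1 diag(d) F\<close>, with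
  \<open>F^-1 = F^* / N\<close>.\<close>

definition filt :: "(nat \<Rightarrow> real) \<Rightarrow> nat \<Rightarrow> nat \<Rightarrow> complex" where
  "filt d i j = (\<Sum>k<N. cnj (F k i) * of_real (d k) * F k j) / of_nat N"

lemma filt_cong: "(\<And>k. k < N \<Longrightarrow> d k = e k) \<Longrightarrow> filt d i j = filt e i j"
  by (simp add: filt_def)

text \<open>The filter is Hermitian because \<open>d\<close> is real. Hence its real part is
  symmetric and its imaginary part antisymmetric.\<close>

lemma filt_swap: "filt d j i = cnj (filt d i j)"
  by (simp add: filt_def mult_ac)

lemma filt_diff: "filt (\<lambda>k. d k - e k) i j = filt d i j - filt e i j"
  by (simp add: filt_def algebra_simps sum_subtractf flip: diff_divide_distrib)

lemma filt_one:
  assumes "i < N" "j < N"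
  shows "filt (\<lambda>_. 1) i j = (if i = j then 1 else 0)"
  using columns[OF assms] N_pos by (simp add: filt_def)

text \<open>In \<open>F^-1 diag(d) F F^-1 diag(e) F\<close> the middle factors cancel; this
  cancellation is row orthogonality.\<close>

lemma filt_mult:
  assumes "i < N" "j < N"
  shows "(\<Sum>m<N. filt d i m * filt e m j) = filt (\<lambda>k. d k * e k) i j"
proof -
  let ?n = "of_nat N :: complex"
  have "(\<Sum>m<N. filt d i m * filt e m j) =
      (\<Sum>m<N. \<Sum>k<N. \<Sum>l<N. (cnj (F k i) * d k * e l * F l j) * (F k m * cnj (F l m))) / (?n * ?n)"
    by (simp add: filt_def sum_product sum_divide_distrib mult_ac)
  \<comment> \<open>The sum over \<open>m\<close> is moved innermost, where row orthogonality
    reduces it to \<open>N\<close> for \<open>k = l\<close> and 0 otherwise. That \<open>N\<close>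
    cancels one of the two in the denominator.\<close>
  also have "(\<Sum>m<N. \<Sum>k<N. \<Sum>l<N. (cnj (F k i) * d k * e l * F l j) * (F k m * cnj (F l m))) =
      (\<Sum>k<N. \<Sum>m<N. \<Sum>l<N. (cnj (F k i) * d k * e l * F l j) * (F k m * cnj (F l m)))"
    by (rule sum.swap)
  also have "\<dots> = (\<Sum>k<N. \<Sum>l<N. \<Sum>m<N. (cnj (F k i) * d k * e l * F l j) * (F k m * cnj (F l m)))"
    by (rule sum.cong[OF refl], rule sum.swap)
  also have "\<dots> = (\<Sum>k<N. \<Sum>l<N. (cnj (F k i) * d k * e l * F l j) * (if k = l then ?n else 0))"
    using rows by (simp add: sum_distrib_left[symmetric])
  also have "\<dots> = (\<Sum>k<N. cnj (F k i) * (d k * e k) * F k j) * ?n"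
    by (simp add: if_distrib[of "\<lambda>x. _ * x"] sum.delta sum_distrib_left mult_ac cong: if_cong)
  finally show ?thesis
    using N_pos by (simp add: filt_def)
qed

section \<open>Gram matrices of the real and imaginary parts of a filter\<close>

text \<open>The matrix \<open>S = Q Q^T\<close> with \<open>Q\<close> the imaginary part of the
  filter; by antisymmetry of \<open>Q\<close> it is also \<open>-Q^2\<close>.\<close>

definition skew_gram :: "(nat \<Rightarrow> real) \<Rightarrow> nat \<Rightarrow> nat \<Rightarrow> real" where
  "skew_gram d i j = (\<Sum>m<N. Im (filt d i m) * Im (filt d j m))"

text \<open>The real part of \<open>(P + iQ)^2\<close> is \<open>P^2 - Q^2\<close>, which equals
  \<open>P P^T + Q Q^T\<close> by the symmetries of \<open>P\<close> and \<open>Q\<close>. The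
  square itself is the filter of \<open>d^2\<close>.\<close>

lemma Re_gram:
  assumes "i < N" "j < N"
  shows "(\<Sum>m<N. Re (filt d i m) * Re (filt d j m)) = Re (filt (\<lambda>k. (d k)\<^sup>2) i j) - skew_gram d i j"
proof -
  have "Re (filt (\<lambda>k. (d k)\<^sup>2) i j) = (\<Sum>m<N. Re (filt d i m * filt d m j))"
    unfolding power2_eq_square filt_mult[OF assms, symmetric] Re_sum ..
  also have "\<dots> = (\<Sum>m<N. Re (filt d i m) * Re (filt d j m)) + skew_gram d i j"
    by (simp add: filt_swap[of d _ j] skew_gram_def sum.distrib)
  finally show ?thesis by simp
qed

text \<open>With \<open>v\<^sub>k\<close> the image of the \<open>k\<close>-th row of \<open>F\<close> under \<open>Im (filt d)\<close>, the inner product equals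
  \<open>(1/N) \<Sum>\<^sub>k e\<^sub>k \<parallel>v\<^sub>k\<parallel>\<^sup>2\<close>.\<close>

lemma skew_gram_inner_nonneg:
  assumes e: "\<And>k. k < N \<Longrightarrow> e k \<ge> 0"
  shows "(\<Sum>i<N. \<Sum>j<N. Re (filt e i j) * skew_gram d i j) \<ge> 0"
proof -
  define v where "v k m = (\<Sum>j<N. F k j * of_real (Im (filt d j m)))" for k m
  have "of_nat N * (filt e i j * of_real (skew_gram d i j)) = (\<Sum>k<N. \<Sum>m<N. of_real (e k) *
        ((cnj (F k i) * of_real (Im (filt d i m))) * (F k j * of_real (Im (filt d j m)))))" for i j
  proof -
    have "of_nat N * (filt e i j * of_real (skew_gram d i j)) =
        (\<Sum>k<N. cnj (F k i) * of_real (e k) * F k j) *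
        (\<Sum>m<N. of_real (Im (filt d i m)) * of_real (Im (filt d j m)))"
      using N_pos by (simp add: filt_def[of e] skew_gram_def)
    then show ?thesis
      by (simp add: sum_product mult_ac)
  qed
  then have "of_nat N * (\<Sum>i<N. \<Sum>j<N. filt e i j * of_real (skew_gram d i j)) =
      (\<Sum>i<N. \<Sum>j<N. \<Sum>k<N. \<Sum>m<N. of_real (e k) *
        ((cnj (F k i) * of_real (Im (filt d i m))) * (F k j * of_real (Im (filt d j m)))))"
    by (simp add: sum_distrib_left)
  \<comment> \<open>The following exchanges bring \<open>k\<close> and \<open>m\<close> outside. The
    remaining double sum over \<open>i\<close> and \<open>j\<close> is then the conjugate of
    \<open>v k m\<close> times \<open>v k m\<close>.\<close>
  also have "\<dots> = (\<Sum>i<N. \<Sum>k<N. \<Sum>j<N. \<Sum>m<N. of_real (e k) *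
        ((cnj (F k i) * of_real (Im (filt d i m))) * (F k j * of_real (Im (filt d j m)))))"
    by (rule sum.cong[OF refl], rule sum.swap)
  also have "\<dots> = (\<Sum>k<N. \<Sum>i<N. \<Sum>j<N. \<Sum>m<N. of_real (e k) *
        ((cnj (F k i) * of_real (Im (filt d i m))) * (F k j * of_real (Im (filt d j m)))))"
    by (rule sum.swap)
  also have "\<dots> = (\<Sum>k<N. \<Sum>i<N. \<Sum>m<N. \<Sum>j<N. of_real (e k) *
        ((cnj (F k i) * of_real (Im (filt d i m))) * (F k j * of_real (Im (filt d j m)))))"
    by (rule sum.cong[OF refl], rule sum.cong[OF refl], rule sum.swap)
  also have "\<dots> = (\<Sum>k<N. \<Sum>m<N. \<Sum>i<N. \<Sum>j<N. of_real (e k) *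
        ((cnj (F k i) * of_real (Im (filt d i m))) * (F k j * of_real (Im (filt d j m)))))"
    by (rule sum.cong[OF refl], rule sum.swap)
  also have "\<dots> = (\<Sum>k<N. \<Sum>m<N. of_real (e k) * (cnj (v k m) * v k m))"
    by (simp add: v_def sum_product flip: sum_distrib_left)
  also have "\<dots> = of_real (\<Sum>k<N. \<Sum>m<N. e k * (norm (v k m))\<^sup>2)"
    by (simp add: complex_norm_square[symmetric] mult.commute[of "cnj _"])
  finally have "Re (of_nat N * (\<Sum>i<N. \<Sum>j<N. filt e i j * of_real (skew_gram d i j)))
      = (\<Sum>k<N. \<Sum>m<N. e k * (norm (v k m))\<^sup>2)"
    by simp
  also have "\<dots> \<ge> 0"
    using e by (intro sum_nonneg mult_nonneg_nonneg) auto
  finally have "real N * (\<Sum>i<N. \<Sum>j<N. Re (filt e i j) * skew_gram d i j) \<ge> 0"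
    by simp
  then show ?thesis
    using N_pos by (simp add: zero_le_mult_iff)
qed

text \<open>The constant filter 1 is the real identity matrix, so the filters of \<open>d\<close>
  and \<open>1 - d\<close> have opposite imaginary parts and the same \<open>S\<close>. Applying
  \<open>Re_gram\<close> to both leaves \<open>1 - d^2 - (1 - d)^2 = 2 (d - d^2)\<close> inside the
  filter and \<open>2 S\<close> outside.\<close>

lemma freeinit_gram:
  assumes "i < N" "j < N"
  shows "(if i = j then 1 else 0) -
      (\<Sum>m<N. Re (filt d i m) * Re (filt d j m) + Re (filt (\<lambda>k. 1 - d k) i m) * Re (filt (\<lambda>k. 1 - d k) j m))
    = 2 * (Re (filt (\<lambda>k. d k - (d k)\<^sup>2) i j) + skew_gram d i j)"
proof -
  have "skew_gram (\<lambda>k. 1 - d k) i j = skew_gram d i j"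
  proof -
    have "Im (filt (\<lambda>k. 1 - d k) l m) = - Im (filt d l m)" if "l < N" "m < N" for l m
      using that by (simp add: filt_diff filt_one)
    then show ?thesis
      using assms by (simp add: skew_gram_def)
  qed
  moreover have "filt (\<lambda>k. (1 - d k)\<^sup>2) i j = (if i = j then 1 else 0) - filt d i j - filt (\<lambda>k. d k - (d k)\<^sup>2) i j"
  proof -
    have "filt (\<lambda>k. (1 - d k)\<^sup>2) i j = filt (\<lambda>k. (1 - d k) - (d k - (d k)\<^sup>2)) i j"
      by (rule filt_cong) (simp add: power2_eq_square algebra_simps)
    then show ?thesis
      by (simp only: filt_diff filt_one[OF assms])
  qed
  ultimately show ?thesis
    unfolding sum.distrib Re_gram[OF assms] unfolding filt_diff by simp
qed

text \<open>The five products are the contributions of \<open>x\<close>, \<open>\<eta>\<^sub>1\<close>, \<open>\<eta>\<^sub>2\<close>, \<open>y\<^sub>1\<close>, \<open>y\<^sub>2\<close>; with \<open>c = cos \<theta>\<close>, the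
  constants \<open>a\<close> and \<open>b\<close> are \<open>cos \<theta>\<close> and \<open>sin \<theta>\<close> divided by \<open>sqrt (2 (1 + c\<^sup>2))\<close>.\<close>

lemma freqprior_gram:
  assumes "i < N" "j < N" and d: "\<And>k. k < N \<Longrightarrow> (d k)\<^sup>2 \<le> 1"
  defines "p \<equiv> \<lambda>i m. Re (filt d i m)" and "q \<equiv> \<lambda>i m. Im (filt d i m)"
    and "p' \<equiv> \<lambda>i m. Re (filt (\<lambda>k. sqrt (1 - (d k)\<^sup>2)) i m)"
    and "q' \<equiv> \<lambda>i m. Im (filt (\<lambda>k. sqrt (1 - (d k)\<^sup>2)) i m)"
  assumes ab: "a\<^sup>2 = c\<^sup>2 / (1 + c\<^sup>2) / 2" "b\<^sup>2 = (1 - c\<^sup>2) / (1 + c\<^sup>2) / 2" "g\<^sup>2 = 1 / 2"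
  shows "(if i = j then 1 else 0) -
      (\<Sum>m<N. (2 * a * p i m) * (2 * a * p j m)
        + (b * (p i m + q i m)) * (b * (p j m + q j m)) + (b * (p i m - q i m)) * (b * (p j m - q j m))
        + (g * (p' i m + q' i m)) * (g * (p' j m + q' j m)) + (g * (p' i m - q' i m)) * (g * (p' j m - q' j m)))
    = c\<^sup>2 / (1 + c\<^sup>2) * (2 * skew_gram d i j)"
proof -
  let ?s = "\<lambda>k. sqrt (1 - (d k)\<^sup>2)"
  define P Q where "P = Re (filt (\<lambda>k. (d k)\<^sup>2) i j)" and "Q = skew_gram d i j"
  \<comment> \<open>The bound on \<open>d\<close> makes the radicand nonnegative, so squaring the
    root gives back \<open>1 - d^2\<close>.\<close>
  have P': "Re (filt (\<lambda>k. (?s k)\<^sup>2) i j) = (if i = j then 1 else 0) - P"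
    using filt_cong[of "\<lambda>k. (?s k)\<^sup>2" "\<lambda>k. 1 - (d k)\<^sup>2" i j] assms(1,2) d
    by (simp add: filt_diff filt_one P_def)
  have pp: "(\<Sum>m<N. p i m * p j m) = P - Q" and qq: "(\<Sum>m<N. q i m * q j m) = Q"
    using Re_gram[OF assms(1,2), of d] by (simp_all add: p_def q_def P_def Q_def skew_gram_def)
  have pq': "(\<Sum>m<N. p' i m * p' j m) + (\<Sum>m<N. q' i m * q' j m) = (if i = j then 1 else 0) - P"
    using Re_gram[OF assms(1,2), of ?s] unfolding P' skew_gram_def p'_def q'_def by linarith
  \<comment> \<open>The mixed products of real and imaginary parts cancel between the terms with sum
    and difference, leaving only the Gram sums evaluated above.\<close>
  have "(\<Sum>m<N. (2 * a * p i m) * (2 * a * p j m)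
        + (b * (p i m + q i m)) * (b * (p j m + q j m)) + (b * (p i m - q i m)) * (b * (p j m - q j m))
        + (g * (p' i m + q' i m)) * (g * (p' j m + q' j m)) + (g * (p' i m - q' i m)) * (g * (p' j m - q' j m)))
      = (\<Sum>m<N. 4 * a\<^sup>2 * (p i m * p j m) + 2 * b\<^sup>2 * (p i m * p j m + q i m * q j m)
        + 2 * g\<^sup>2 * (p' i m * p' j m + q' i m * q' j m))"
    by (intro sum.cong refl) (simp add: power2_eq_square algebra_simps)
  also have "\<dots> = 4 * a\<^sup>2 * (P - Q) + 2 * b\<^sup>2 * P + 2 * g\<^sup>2 * ((if i = j then 1 else 0) - P)"
    using pp qq pq' by (simp add: sum.distrib flip: sum_distrib_left)
  finally have eq: "(\<Sum>m<N. (2 * a * p i m) * (2 * a * p j m)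
        + (b * (p i m + q i m)) * (b * (p j m + q j m)) + (b * (p i m - q i m)) * (b * (p j m - q j m))
        + (g * (p' i m + q' i m)) * (g * (p' j m + q' j m)) + (g * (p' i m - q' i m)) * (g * (p' j m - q' j m)))
      = 4 * a\<^sup>2 * (P - Q) + 2 * b\<^sup>2 * P + 2 * g\<^sup>2 * ((if i = j then 1 else 0) - P)" .
  have "1 + c\<^sup>2 \<noteq> 0"
    using sum_power2_gt_zero_iff[of 1 c] by simp
  \<comment> \<open>In terms of \<kappa>, \<open>4 a^2\<close> is 2\<kappa>, \<open>2 b^2\<close> is
    1 - 2\<kappa> and \<open>2 g^2\<close> is 1. All multiples of \<open>P\<close> then cancel and
    only 2\<kappa> \<open>Q\<close> is left.\<close>
  define \<kappa> where "\<kappa> = c\<^sup>2 / (1 + c\<^sup>2)"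
  have \<kappa>: "(1 - c\<^sup>2) / (1 + c\<^sup>2) = 1 - 2 * \<kappa>"
    using \<open>1 + c\<^sup>2 \<noteq> 0\<close> by (simp add: \<kappa>_def field_simps)
  show ?thesis
    unfolding eq ab Q_def[symmetric] \<kappa>_def[symmetric] \<kappa> by (simp add: field_simps)
qed

end

section \<open>Covariance errors of the refined noises\<close>

lemma scaled_unitary_dft3:
  assumes pos: "f > 0" "h > 0" "w > 0" and N: "N = f * h * w"
  shows "scaled_unitary N (\<lambda>k j. dft3 f h w $$ (k, j))"
proof
  show "N > 0" using assms by simp
  have F: "dft3 f h w \<in> carrier_mat N N" using dft3_carrier N by simp
  fix i j assume ij: "i < N" "j < N"
  show "(\<Sum>k<N. cnj (dft3 f h w $$ (k, i)) * dft3 f h w $$ (k, j)) = (if i = j then of_nat N else 0)"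
    using orthogonal_columns_dft3[of f h w] F ij by (simp add: orthogonal_columns_def)
  \<comment> \<open>Row orthogonality is \<open>F F^-1 = I\<close> read entrywise, with the explicit
    form of the inverse inserted.\<close>
  have "(\<Sum>k<N. dft3 f h w $$ (i, k) * cnj (dft3 f h w $$ (j, k))) / of_nat N
      = (dft3 f h w * dft3_inv f h w) $$ (i, j)"
    using F ij dft3_inverts(1)[OF pos N]
    by (simp add: scalar_prod_def atLeast0LessThan sum_divide_distrib)
  then show "(\<Sum>k<N. dft3 f h w $$ (i, k) * cnj (dft3 f h w $$ (j, k))) = (if i = j then of_nat N else 0)"
    using dft3_inverts(2)[OF pos N] ij by (auto simp: field_simps split: if_splits)
qed

text \<open>This links the matrix products in the definitions of the noises to the entry functions
  \<open>filt\<close>.\<close>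

lemma filter_mult_vec:
  assumes pos: "f > 0" "h > 0" "w > 0" and N: "N = f * h * w"
    and D: "D \<in> carrier_mat N N" "diagonal_mat D" and v: "v \<in> carrier_vec N" and i: "i < N"
  shows "((dft3_inv f h w * map_mat complex_of_real D * dft3 f h w) *\<^sub>v map_vec complex_of_real v) $ i
    = (\<Sum>m<N. scaled_unitary.filt N (\<lambda>k j. dft3 f h w $$ (k, j)) (\<lambda>k. D $$ (k, k)) i m * of_real (v $ m))"
proof -
  interpret scaled_unitary N "\<lambda>k j. dft3 f h w $$ (k, j)"
    using pos N by (rule scaled_unitary_dft3)
  have F: "dft3 f h w \<in> carrier_mat N N" using dft3_carrier N by simp
  have FD: "(dft3_inv f h w * map_mat complex_of_real D) $$ (i, k)
      = cnj (dft3 f h w $$ (k, i)) / of_nat N * of_real (D $$ (k, k))" if k: "k < N" for k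
  proof -
    have "(dft3_inv f h w * map_mat complex_of_real D) $$ (i, k)
        = (\<Sum>l<N. cnj (dft3 f h w $$ (l, i)) / of_nat N * of_real (D $$ (l, k)))"
      using D i k dft3_inverts(1)[OF pos N] by (simp add: scalar_prod_def atLeast0LessThan)
    also have "\<dots> = (\<Sum>l<N. if l = k then cnj (dft3 f h w $$ (k, i)) / of_nat N * of_real (D $$ (k, k)) else 0)"
      using D k by (intro sum.cong) (auto simp: diagonal_mat_def)
    finally show ?thesis using k by simp
  qed
  have "(dft3_inv f h w * map_mat complex_of_real D * dft3 f h w) $$ (i, m) = filt (\<lambda>k. D $$ (k, k)) i m"
    if m: "m < N" for m
  proof -
    have "(dft3_inv f h w * map_mat complex_of_real D * dft3 f h w) $$ (i, m)
        = (\<Sum>k<N. (dft3_inv f h w * map_mat complex_of_real D) $$ (i, k) * dft3 f h w $$ (k, m))"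
      using D F i m dft3_inverts(1)[OF pos N]
      by (simp add: scalar_prod_def atLeast0LessThan del: index_mult_mat(1))
         (simp add: scalar_prod_def atLeast0LessThan)
    then show ?thesis
      by (simp add: FD filt_def sum_divide_distrib)
  qed
  then show ?thesis
    using D F i v dft3_inverts(1)[OF pos N]
    by (simp add: mult_mat_vec_def scalar_prod_def atLeast0LessThan del: index_mult_mat(1))
qed

lemma std_gaussian_vec_carrier:
  "std_gaussian_vec M N X \<Longrightarrow> \<omega> \<in> space M \<Longrightarrow> X \<omega> \<in> carrier_vec N"
  using measurable_space[of X M "vec_borel N" \<omega>] by (simp add: std_gaussian_vec_def space_vec_borel)

lemma frobenius_norm_scale:
  "frobenius_norm (Matrix.mat m n (\<lambda>(i, j). c * g i j)) = \<bar>c\<bar> * sqrt (\<Sum>i<m. \<Sum>j<n. (g i j :: real)\<^sup>2)"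
  by (simp add: frobenius_norm_def power_mult_distrib real_sqrt_mult flip: sum_distrib_left)

section \<open>Deviation of each covariance matrix from the identity\<close>

context
  fixes f h w N :: nat and \<Lambda> :: "real mat"
  assumes pos: "f > 0" "h > 0" "w > 0" and N: "N = f * h * w"
    and \<Lambda>: "\<Lambda> \<in> carrier_mat N N" "diagonal_mat \<Lambda>"
begin

interpretation scaled_unitary N "\<lambda>k j. dft3 f h w $$ (k, j)"
  using pos N by (rule scaled_unitary_dft3)

text \<open>As \<open>x\<close> and \<open>y\<close> are real, taking real parts of the noise only
  affects the coefficients. The noise is thus a linear form in \<open>x\<close> and
  \<open>y\<close>, and \<open>freeinit_gram\<close> evaluates its covariance.\<close>

lemma freeinit_deviation:
  assumes "prob_space M" "std_gaussian_vec M N x" "std_gaussian_vec M N y"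
    and "prob_space.indep_var M (vec_borel N) x (vec_borel N) y"
  shows "1\<^sub>m N - covariance_mat M N (\<lambda>\<omega>. freeinit_noise f h w \<Lambda> (x \<omega>) (y \<omega>))
    = Matrix.mat N N (\<lambda>(i, j). 2 * (Re (filt (\<lambda>k. \<Lambda> $$ (k, k) - (\<Lambda> $$ (k, k))\<^sup>2) i j)
        + skew_gram (\<lambda>k. \<Lambda> $$ (k, k)) i j))"
proof -
  interpret prob_space M by fact
  let ?d = "\<lambda>k. \<Lambda> $$ (k, k)"
  let ?L = "\<lambda>k i m. [Re (filt ?d i m), Re (filt (\<lambda>k. 1 - ?d k) i m)] ! k"
  have two: "{..<2} = {0, 1::nat}" by auto
  have diag: "1\<^sub>m N - \<Lambda> \<in> carrier_mat N N" "diagonal_mat (1\<^sub>m N - \<Lambda>)"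
    using \<Lambda> by (auto simp: diagonal_mat_def)
  have "covariance_mat M N (\<lambda>\<omega>. freeinit_noise f h w \<Lambda> (x \<omega>) (y \<omega>))
      = Matrix.mat N N (\<lambda>(i, j). \<Sum>k<2. \<Sum>m<N. ?L k i m * ?L k j m)"
  proof (rule covariance_gaussian_linear_forms[where X = "\<lambda>k. [x, y] ! k"])
    fix k l :: nat assume "k < l" "l < 2"
    then show "indep_var (vec_borel N) ([x, y] ! k) (vec_borel N) ([x, y] ! l)"
      using assms(4) by (auto simp: less_2_cases_iff)
  next
    fix \<omega> i assume \<omega>: "\<omega> \<in> space M" and i: "i < N"
    have xy: "x \<omega> \<in> carrier_vec N" "y \<omega> \<in> carrier_vec N"
      using assms(2,3) \<omega> by (auto intro: std_gaussian_vec_carrier)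
    have "filt (\<lambda>k. (1\<^sub>m N - \<Lambda>) $$ (k, k)) i m = filt (\<lambda>k. 1 - ?d k) i m" for m
      using \<Lambda> by (intro filt_cong) auto
    then have "freeinit_noise f h w \<Lambda> (x \<omega>) (y \<omega>) $ i =
        Re ((\<Sum>m<N. filt ?d i m * of_real (x \<omega> $ m)) + (\<Sum>m<N. filt (\<lambda>k. 1 - ?d k) i m * of_real (y \<omega> $ m)))"
      using i filter_mult_vec[OF pos N \<Lambda> xy(1) i] filter_mult_vec[OF pos N diag xy(2) i]
        dft3_inverts(1)[OF pos N]
      by (simp add: freeinit_noise_def Let_def flip: N)
    then show "freeinit_noise f h w \<Lambda> (x \<omega>) (y \<omega>) $ i = (\<Sum>k<2. \<Sum>m<N. ?L k i m * ([x, y] ! k) \<omega> $ m)"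
      by (simp add: two)
  qed (use assms(2,3) in \<open>auto simp: less_2_cases_iff\<close>)
  then show ?thesis
    by (intro eq_matI) (simp_all add: two freeinit_gram flip: sum.distrib)
qed

text \<open>Each of the five independent vectors adds the Gram matrix of its own coefficients, and
  \<open>freqprior_gram\<close> evaluates the total.\<close>

lemma freqprior_deviation:
  assumes "prob_space M" and gauss: "\<forall>X \<in> set [x, \<eta>\<^sub>1, \<eta>\<^sub>2, y\<^sub>1, y\<^sub>2]. std_gaussian_vec M N X"
    and indep: "prob_space.indep_vars M (\<lambda>_. vec_borel N) (\<lambda>k. [x, \<eta>\<^sub>1, \<eta>\<^sub>2, y\<^sub>1, y\<^sub>2] ! k) {..<5}"
    and bounds: "\<forall>i<N. 0 \<le> \<Lambda> $$ (i, i) \<and> \<Lambda> $$ (i, i) \<le> 1"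
  shows "1\<^sub>m N - covariance_mat M N
      (\<lambda>\<omega>. freqprior_noise f h w \<Lambda> \<theta> (x \<omega>) (\<eta>\<^sub>1 \<omega>) (\<eta>\<^sub>2 \<omega>) (y\<^sub>1 \<omega>) (y\<^sub>2 \<omega>))
    = Matrix.mat N N (\<lambda>(i, j). (cos \<theta>)\<^sup>2 / (1 + (cos \<theta>)\<^sup>2) * (2 * skew_gram (\<lambda>k. \<Lambda> $$ (k, k)) i j))"
proof -
  interpret prob_space M by fact
  let ?d = "\<lambda>k. \<Lambda> $$ (k, k)"
  let ?s = "\<lambda>k. sqrt (1 - (?d k)\<^sup>2)"
  let ?X = "[x, \<eta>\<^sub>1, \<eta>\<^sub>2, y\<^sub>1, y\<^sub>2]"
  define p q p' q' where "p i m = Re (filt ?d i m)" and "q i m = Im (filt ?d i m)"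
    and "p' i m = Re (filt ?s i m)" and "q' i m = Im (filt ?s i m)" for i m
  define r where "r = 1 / sqrt (1 + (cos \<theta>)\<^sup>2)"
  define g :: real where "g = 1 / sqrt 2"
  \<comment> \<open>These absorb the final 1 / sqrt 2 and the normalisation of the mixed
    vectors.\<close>
  define a b where "a = g * (r * cos \<theta>)" and "b = g * (r * sin \<theta>)"
  \<comment> \<open>The vector \<open>x\<close> is shared by both branches, so its imaginary
    contributions cancel and its real ones double. Each of the other vectors enters one branch only
    and keeps real plus or minus imaginary part.\<close>
  let ?L = "\<lambda>k i m. [2 * a * p i m, b * (p i m + q i m), b * (p i m - q i m),
      g * (p' i m + q' i m), g * (p' i m - q' i m)] ! k"
  have five: "{..<5} = {0, 1, 2, 3, 4::nat}" by auto
  have sq: "(?d k)\<^sup>2 \<le> 1" if "k < N" for k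
    using bounds that by (auto simp: abs_square_le_1)
  have \<Lambda>\<Lambda>: "(\<Lambda> * \<Lambda>) $$ (k, k) = (?d k)\<^sup>2" if "k < N" for k
  proof -
    have "(\<Lambda> * \<Lambda>) $$ (k, k) = (\<Sum>l<N. \<Lambda> $$ (k, l) * \<Lambda> $$ (l, k))"
      using \<Lambda> that by (simp add: scalar_prod_def atLeast0LessThan)
    also have "\<dots> = (\<Sum>l<N. if l = k then ?d k * ?d k else 0)"
      using \<Lambda> that by (intro sum.cong) (auto simp: diagonal_mat_def)
    finally show ?thesis using that by (simp add: power2_eq_square)
  qed
  have diag: "diag_sqrt (1\<^sub>m N - \<Lambda> * \<Lambda>) \<in> carrier_mat N N" "diagonal_mat (diag_sqrt (1\<^sub>m N - \<Lambda> * \<Lambda>))"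
    using \<Lambda> by (auto simp: diag_sqrt_def diagonal_mat_def mat_diag_def)
  have filt_s: "filt (\<lambda>k. diag_sqrt (1\<^sub>m N - \<Lambda> * \<Lambda>) $$ (k, k)) i m = filt ?s i m" for i m
    using \<Lambda> \<Lambda>\<Lambda> by (intro filt_cong) (simp add: diag_sqrt_def mat_diag_def)
  have filter: "freqprior_filter f h w \<Lambda> u v $ i =
      (\<Sum>m<N. filt ?d i m * of_real (u $ m)) + (\<Sum>m<N. filt ?s i m * of_real (v $ m))"
    if "u \<in> carrier_vec N" "v \<in> carrier_vec N" "i < N" for u v i
    using that filter_mult_vec[OF pos N \<Lambda> that(1,3)] filter_mult_vec[OF pos N diag that(2,3)]
      dft3_inverts(1)[OF pos N] filt_s
    by (simp add: freqprior_filter_def Let_def flip: N)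
  have dim_filter: "dim_vec (freqprior_filter f h w \<Lambda> u v) = N" for u v
    using dft3_inverts(1)[OF pos N] by (simp add: freqprior_filter_def Let_def)
  have "covariance_mat M N (\<lambda>\<omega>. freqprior_noise f h w \<Lambda> \<theta> (x \<omega>) (\<eta>\<^sub>1 \<omega>) (\<eta>\<^sub>2 \<omega>) (y\<^sub>1 \<omega>) (y\<^sub>2 \<omega>))
      = Matrix.mat N N (\<lambda>(i, j). \<Sum>k<5. \<Sum>m<N. ?L k i m * ?L k j m)"
  proof (rule covariance_gaussian_linear_forms[where X = "\<lambda>k. ?X ! k"])
    fix k :: nat assume "k < 5"
    then show "std_gaussian_vec M N (?X ! k)"
      using gauss nth_mem[of k ?X] by auto
  next
    fix k l :: nat assume "k < l" "l < 5"
    then show "indep_var (vec_borel N) (?X ! k) (vec_borel N) (?X ! l)"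
      by (intro indep_vars_imp_indep_var[OF indep]) auto
  next
    fix \<omega> i assume \<omega>: "\<omega> \<in> space M" and i: "i < N"
    have car: "X \<omega> \<in> carrier_vec N" if "X \<in> set ?X" for X
      using gauss \<omega> that by (auto intro: std_gaussian_vec_carrier)
    have mix: "freqprior_mix \<theta> (x \<omega>) (\<eta> \<omega>) \<in> carrier_vec N"
      "m < N \<Longrightarrow> freqprior_mix \<theta> (x \<omega>) (\<eta> \<omega>) $ m = r * (cos \<theta> * x \<omega> $ m + sin \<theta> * \<eta> \<omega> $ m)"
      if "\<eta> \<in> set ?X" for \<eta> m
      using car[of x] car[OF that] by (auto simp: freqprior_mix_def r_def)
    have z1: "freqprior_filter f h w \<Lambda> (freqprior_mix \<theta> (x \<omega>) (\<eta>\<^sub>1 \<omega>)) (y\<^sub>1 \<omega>) $ i =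
      (\<Sum>m<N. filt ?d i m * of_real (r * (cos \<theta> * x \<omega> $ m + sin \<theta> * \<eta>\<^sub>1 \<omega> $ m)) + filt ?s i m * of_real (y\<^sub>1 \<omega> $ m))"
      using filter[OF mix(1) car i, of \<eta>\<^sub>1 y\<^sub>1] mix(2)[of \<eta>\<^sub>1] by (simp add: sum.distrib)
    have z2: "freqprior_filter f h w \<Lambda> (freqprior_mix \<theta> (x \<omega>) (\<eta>\<^sub>2 \<omega>)) (y\<^sub>2 \<omega>) $ i =
      (\<Sum>m<N. filt ?d i m * of_real (r * (cos \<theta> * x \<omega> $ m + sin \<theta> * \<eta>\<^sub>2 \<omega> $ m)) + filt ?s i m * of_real (y\<^sub>2 \<omega> $ m))"
      using filter[OF mix(1) car i, of \<eta>\<^sub>2 y\<^sub>2] mix(2)[of \<eta>\<^sub>2] by (simp add: sum.distrib)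
    have "freqprior_noise f h w \<Lambda> \<theta> (x \<omega>) (\<eta>\<^sub>1 \<omega>) (\<eta>\<^sub>2 \<omega>) (y\<^sub>1 \<omega>) (y\<^sub>2 \<omega>) $ i =
      g * ((\<Sum>m<N. p i m * (r * (cos \<theta> * x \<omega> $ m + sin \<theta> * \<eta>\<^sub>1 \<omega> $ m)) + p' i m * y\<^sub>1 \<omega> $ m) +
        (\<Sum>m<N. q i m * (r * (cos \<theta> * x \<omega> $ m + sin \<theta> * \<eta>\<^sub>1 \<omega> $ m)) + q' i m * y\<^sub>1 \<omega> $ m) +
        (\<Sum>m<N. p i m * (r * (cos \<theta> * x \<omega> $ m + sin \<theta> * \<eta>\<^sub>2 \<omega> $ m)) + p' i m * y\<^sub>2 \<omega> $ m) -
        (\<Sum>m<N. q i m * (r * (cos \<theta> * x \<omega> $ m + sin \<theta> * \<eta>\<^sub>2 \<omega> $ m)) + q' i m * y\<^sub>2 \<omega> $ m))"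
      using i z1 z2 dim_filter
      by (simp add: freqprior_noise_def Let_def g_def p_def q_def p'_def q'_def del: of_real_mult of_real_add)
    \<comment> \<open>The terms are regrouped by Gaussian vector, which yields the coefficients
      \<open>?L\<close>.\<close>
    also have "\<dots> = (\<Sum>m<N. 2 * a * p i m * x \<omega> $ m + b * (p i m + q i m) * \<eta>\<^sub>1 \<omega> $ m
        + b * (p i m - q i m) * \<eta>\<^sub>2 \<omega> $ m + g * (p' i m + q' i m) * y\<^sub>1 \<omega> $ m + g * (p' i m - q' i m) * y\<^sub>2 \<omega> $ m)"
      unfolding sum.distrib[symmetric] sum_subtractf[symmetric] sum_distrib_left a_def b_def
      by (intro sum.cong refl) (simp add: algebra_simps)
    finally show "freqprior_noise f h w \<Lambda> \<theta> (x \<omega>) (\<eta>\<^sub>1 \<omega>) (\<eta>\<^sub>2 \<omega>) (y\<^sub>1 \<omega>) (y\<^sub>2 \<omega>) $ i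
        = (\<Sum>k<5. \<Sum>m<N. ?L k i m * (?X ! k) \<omega> $ m)"
      by (simp add: five sum.distrib)
  qed
  moreover have "(if i = j then 1 else 0) - (\<Sum>k<5. \<Sum>m<N. ?L k i m * ?L k j m)
      = (cos \<theta>)\<^sup>2 / (1 + (cos \<theta>)\<^sup>2) * (2 * skew_gram ?d i j)" if ij: "i < N" "j < N" for i j
  proof -
    have r2: "r\<^sup>2 = 1 / (1 + (cos \<theta>)\<^sup>2)" and g2: "g\<^sup>2 = 1 / 2"
      by (simp_all add: r_def g_def power_divide)
    have "a\<^sup>2 = (cos \<theta>)\<^sup>2 / (1 + (cos \<theta>)\<^sup>2) / 2" "b\<^sup>2 = (1 - (cos \<theta>)\<^sup>2) / (1 + (cos \<theta>)\<^sup>2) / 2"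
      by (simp_all add: a_def b_def power_mult_distrib r2 g2 sin_squared_eq)
    from freqprior_gram[where d = ?d, OF ij sq this g2, folded p_def q_def p'_def q'_def]
    show ?thesis
      by (simp add: five sum.distrib)
  qed
  ultimately show ?thesis
    by (intro eq_matI) simp_all
qed

section \<open>Comparison of the two covariance errors\<close>

text \<open>Both deviations are determined by the filter and \<theta>, so the two noises may live on
  different probability spaces. What remains is to compare the norms of \<open>S\<close> and
  \<open>R + S\<close>.\<close>

lemma covariance_error_le:
  assumes bounds: "\<forall>i<N. 0 \<le> \<Lambda> $$ (i, i) \<and> \<Lambda> $$ (i, i) \<le> 1"
    and "prob_space M" "std_gaussian_vec M N x" "std_gaussian_vec M N y"
    and "prob_space.indep_var M (vec_borel N) x (vec_borel N) y"
    and "prob_space M'" "\<forall>X \<in> set [x', \<eta>\<^sub>1, \<eta>\<^sub>2, y\<^sub>1, y\<^sub>2]. std_gaussian_vec M' N X"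
    and "prob_space.indep_vars M' (\<lambda>_. vec_borel N) (\<lambda>k. [x', \<eta>\<^sub>1, \<eta>\<^sub>2, y\<^sub>1, y\<^sub>2] ! k) {..<5}"
  shows "frobenius_norm (1\<^sub>m N - covariance_mat M' N
           (\<lambda>\<omega>. freqprior_noise f h w \<Lambda> \<theta> (x' \<omega>) (\<eta>\<^sub>1 \<omega>) (\<eta>\<^sub>2 \<omega>) (y\<^sub>1 \<omega>) (y\<^sub>2 \<omega>)))
      \<le> (cos \<theta>)\<^sup>2 / (1 + (cos \<theta>)\<^sup>2) *
         frobenius_norm (1\<^sub>m N - covariance_mat M N (\<lambda>\<omega>. freeinit_noise f h w \<Lambda> (x \<omega>) (y \<omega>)))"
proof -
  let ?d = "\<lambda>k. \<Lambda> $$ (k, k)"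
  let ?R = "\<lambda>i j. Re (filt (\<lambda>k. ?d k - (?d k)\<^sup>2) i j)"
  let ?S = "skew_gram ?d"
  let ?\<kappa> = "(cos \<theta>)\<^sup>2 / (1 + (cos \<theta>)\<^sup>2)"
  have "(\<Sum>i<N. \<Sum>j<N. (?R i j + ?S i j)\<^sup>2) =
      (\<Sum>i<N. \<Sum>j<N. (?R i j)\<^sup>2) + 2 * (\<Sum>i<N. \<Sum>j<N. ?R i j * ?S i j) + (\<Sum>i<N. \<Sum>j<N. (?S i j)\<^sup>2)"
    by (simp add: power2_sum sum.distrib sum_distrib_left mult_ac)
  \<comment> \<open>The weights \<open>d - d^2\<close> are nonnegative because the diagonal entries
    lie in [0, 1].\<close>
  moreover have "(\<Sum>i<N. \<Sum>j<N. ?R i j * ?S i j) \<ge> 0"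
    using bounds by (intro skew_gram_inner_nonneg) (simp add: power2_eq_square mult_left_le)
  moreover have "(\<Sum>i<N. \<Sum>j<N. (?R i j)\<^sup>2) \<ge> 0"
    by (intro sum_nonneg) simp
  ultimately have le: "(\<Sum>i<N. \<Sum>j<N. (?S i j)\<^sup>2) \<le> (\<Sum>i<N. \<Sum>j<N. (?R i j + ?S i j)\<^sup>2)"
    by linarith
  have "frobenius_norm (Matrix.mat N N (\<lambda>(i, j). ?\<kappa> * (2 * ?S i j))) =
      \<bar>?\<kappa> * 2\<bar> * sqrt (\<Sum>i<N. \<Sum>j<N. (?S i j)\<^sup>2)"
    using frobenius_norm_scale[of N N "?\<kappa> * 2" ?S] by (simp only: mult.assoc)
  also have "\<dots> = ?\<kappa> * (2 * sqrt (\<Sum>i<N. \<Sum>j<N. (?S i j)\<^sup>2))"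
    by simp
  also have "\<dots> \<le> ?\<kappa> * (2 * sqrt (\<Sum>i<N. \<Sum>j<N. (?R i j + ?S i j)\<^sup>2))"
    using le by (intro mult_left_mono) auto
  also have "2 * sqrt (\<Sum>i<N. \<Sum>j<N. (?R i j + ?S i j)\<^sup>2) =
      frobenius_norm (Matrix.mat N N (\<lambda>(i, j). 2 * (?R i j + ?S i j)))"
    using frobenius_norm_scale[of N N 2 "\<lambda>i j. ?R i j + ?S i j"] by simp
  finally show ?thesis
    unfolding freeinit_deviation[OF assms(2-5)] freqprior_deviation[OF assms(6-8) bounds] .
qed

end

theorem mainTheorem1:
  fixes f h w N :: nat
    and \<Lambda> :: "real mat"
    and \<theta> :: real
    and M :: "'a measure" and x y :: "'a \<Rightarrow> real Matrix.vec"
    and M' :: "'b measure" and x' \<eta>\<^sub>1 \<eta>\<^sub>2 y\<^sub>1 y\<^sub>2 :: "'b \<Rightarrow> real Matrix.vec"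
    and \<Sigma>_FreeInit \<Sigma>_FreqPrior :: "real mat"
  assumes "f > 0" and "h > 0" and "w > 0" and "N = f * h * w"
    and "\<Lambda> \<in> carrier_mat N N" and "diagonal_mat \<Lambda>"
    and "\<forall>i<N. 0 \<le> \<Lambda> $$ (i, i) \<and> \<Lambda> $$ (i, i) \<le> 1"
    and "prob_space M"
    and "std_gaussian_vec M N x" and "std_gaussian_vec M N y"
    and "prob_space.indep_var M (vec_borel N) x (vec_borel N) y"
    and "prob_space M'"
    and "\<forall>X \<in> set [x', \<eta>\<^sub>1, \<eta>\<^sub>2, y\<^sub>1, y\<^sub>2]. std_gaussian_vec M' N X"
    and "prob_space.indep_vars M' (\<lambda>_. vec_borel N) (\<lambda>k. [x', \<eta>\<^sub>1, \<eta>\<^sub>2, y\<^sub>1, y\<^sub>2] ! k) {..<5}"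
    and "\<Sigma>_FreeInit = covariance_mat M N (\<lambda>\<omega>. freeinit_noise f h w \<Lambda> (x \<omega>) (y \<omega>))"
    and "\<Sigma>_FreqPrior = covariance_mat M' N
           (\<lambda>\<omega>. freqprior_noise f h w \<Lambda> \<theta> (x' \<omega>) (\<eta>\<^sub>1 \<omega>) (\<eta>\<^sub>2 \<omega>) (y\<^sub>1 \<omega>) (y\<^sub>2 \<omega>))"
  shows "frobenius_norm (1\<^sub>m N - \<Sigma>_FreqPrior)
           \<le> (cos \<theta>)\<^sup>2 / (1 + (cos \<theta>)\<^sup>2) * frobenius_norm (1\<^sub>m N - \<Sigma>_FreeInit)
         \<and> (frobenius_norm (1\<^sub>m N - \<Sigma>_FreeInit) \<noteq> 0 \<longrightarrow>
              1 - frobenius_norm (1\<^sub>m N - \<Sigma>_FreqPrior) / frobenius_norm (1\<^sub>m N - \<Sigma>_FreeInit)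
                \<ge> 1 / (1 + (cos \<theta>)\<^sup>2)
              \<and> 1 / (1 + (cos \<theta>)\<^sup>2) \<ge> 1 / 2)"
proof -
  have le: "frobenius_norm (1\<^sub>m N - \<Sigma>_FreqPrior)
      \<le> (cos \<theta>)\<^sup>2 / (1 + (cos \<theta>)\<^sup>2) * frobenius_norm (1\<^sub>m N - \<Sigma>_FreeInit)"
    unfolding assms(15,16) using assms(1-14) by (intro covariance_error_le) auto
  have pos: "1 + (cos \<theta>)\<^sup>2 > 0" and le2: "1 + (cos \<theta>)\<^sup>2 \<le> 2"
    by (simp_all add: add_pos_nonneg abs_square_le_1)
  have "1 - frobenius_norm (1\<^sub>m N - \<Sigma>_FreqPrior) / frobenius_norm (1\<^sub>m N - \<Sigma>_FreeInit)
      \<ge> 1 / (1 + (cos \<theta>)\<^sup>2)" if "frobenius_norm (1\<^sub>m N - \<Sigma>_FreeInit) \<noteq> 0"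
  proof -
    \<comment> \<open>A norm is nonnegative, so a nonzero one is positive and the inequality may be
      divided by it.\<close>
    have "frobenius_norm (1\<^sub>m N - \<Sigma>_FreeInit) > 0"
      using that by (simp add: frobenius_norm_def less_le sum_nonneg)
    then have "frobenius_norm (1\<^sub>m N - \<Sigma>_FreqPrior) / frobenius_norm (1\<^sub>m N - \<Sigma>_FreeInit)
        \<le> (cos \<theta>)\<^sup>2 / (1 + (cos \<theta>)\<^sup>2)"
      using le by (simp add: pos_divide_le_eq)
    also have "\<dots> = 1 - 1 / (1 + (cos \<theta>)\<^sup>2)"
      using pos by (simp add: field_simps)
    finally show ?thesis by simp
  qed
  moreover have "1 / (1 + (cos \<theta>)\<^sup>2) \<ge> 1 / 2"
    using pos le2 by (intro divide_left_mono) auto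
  ultimately show ?thesis using le by blast
qed

end
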